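(* Let $A$ be a nonzero unital commutative $C^*$-algebra. Then $\|f\|_m = \|f\|_{\mathrm{dec}}$ for every $f \in A$.
   Context: A unital $C^*$-algebra $A$ with unit $e$ is regarded as an ordered $*$-vector space with its usual involution, $A^+$ the usual cone of positive elements, $A_h$ the self-adjoint elements, and (Archimedean) order unit $e$. A state on $A$ is a $\mathbb{C}$-linear functional $s:A\to\mathbb{C}$ with $s(A^+)\subseteq[0,\infty)$ and $s(e)=1$. For $v,w\in A_h$, $v\ge w$ means $v-w\in A^+$, and the order norm on $A_h$ is $\|v\|:=\inf\{r\in\mathbb{R}: re+v\ge0\text{ and }re-v\ge0\}$. The minimal order norm on $A$ is $\|f\|_m:=\sup\{|s(f)| : s:A\to\mathbb{C}\text{ is a state}\}$. The decomposition norm on $A$ is $$\|f\|_{\mathrm{dec}} := \inf \left\{ \left\| \sum_{i=1}^n |\lambda_i|p_i \right\| : f = \sum_{i=1}^n \lambda_i p_i \text{ with } p_i \in A^+ \text{ and } \lambda_i \in \mathbb{C} \right\}.$$ *)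

theory Defs
  imports "HOL-Analysis.Analysis"
begin

text \<open>
  Unital \<open>C\<^sup>*\<close>-algebras, with the whole type as carrier. The superclass
  \<^class>\<open>real_normed_algebra_1\<close> requires \<open>0 \<noteq> 1\<close>, so the algebra is nonzero; it also
  requires \<open>norm 1 = 1\<close>, which in a nonzero algebra is a consequence of the
  \<open>C\<^sup>*\<close>-identity. The real scalar multiplication is the restriction of the complex one.
\<close>

class unital_cstar_algebra = real_normed_algebra_1 + banach +
  fixes scaleC :: "complex \<Rightarrow> 'a \<Rightarrow> 'a" (infixr "*\<^sub>C" 75)
    and adj :: "'a \<Rightarrow> 'a"
  assumes scaleC_add_right: "z *\<^sub>C (x + y) = z *\<^sub>C x + z *\<^sub>C y"
    and scaleC_add_left: "(z + w) *\<^sub>C x = z *\<^sub>C x + w *\<^sub>C x"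
    and scaleC_scaleC: "z *\<^sub>C (w *\<^sub>C x) = (z * w) *\<^sub>C x"
    and scaleC_one: "1 *\<^sub>C x = x"
    and scaleR_scaleC: "r *\<^sub>R x = complex_of_real r *\<^sub>C x"
    and mult_scaleC_left: "(z *\<^sub>C x) * y = z *\<^sub>C (x * y)"
    and mult_scaleC_right: "x * (z *\<^sub>C y) = z *\<^sub>C (x * y)"
    and norm_scaleC: "norm (z *\<^sub>C x) = cmod z * norm x"
    and adj_add: "adj (x + y) = adj x + adj y"
    and adj_scaleC: "adj (z *\<^sub>C x) = cnj z *\<^sub>C adj x"
    and adj_mult: "adj (x * y) = adj y * adj x"
    and adj_adj: "adj (adj x) = x"
    and cstar_identity: "norm (adj x * x) = (norm x)\<^sup>2"

lemma vector_space_scaleC: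
  "vector_space (scaleC :: complex \<Rightarrow> 'a::unital_cstar_algebra \<Rightarrow> 'a)"
  by unfold_locales (simp_all add: scaleC_add_right scaleC_add_left scaleC_scaleC scaleC_one)

definition pos_cone :: "'a::unital_cstar_algebra set" where
  "pos_cone = {adj b * b | b. True}"

definition is_state :: "('a::unital_cstar_algebra \<Rightarrow> complex) \<Rightarrow> bool" where
  "is_state s \<longleftrightarrow>
     Vector_Spaces.linear scaleC (*) s \<and> s ` pos_cone \<subseteq> \<real>\<^sub>\<ge>\<^sub>0 \<and> s 1 = 1"

text \<open>
  The order norm is meaningful only on self-adjoint elements; in \<open>dec_norm\<close> it is applied to
  nonnegative combinations of positive elements.
\<close>

definition order_norm :: "'a::unital_cstar_algebra \<Rightarrow> real" where
  "order_norm v = Inf {r. r *\<^sub>R 1 + v \<in> pos_cone \<and> r *\<^sub>R 1 - v \<in> pos_cone}"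

definition min_norm :: "'a::unital_cstar_algebra \<Rightarrow> real" where
  "min_norm f = Sup {cmod (s f) | s. is_state s}"

definition dec_norm :: "'a::unital_cstar_algebra \<Rightarrow> real" where
  "dec_norm f = Inf {order_norm (\<Sum>i=1..n. cmod (l i) *\<^sub>R p i) | (n::nat) l p.
     f = (\<Sum>i=1..n. l i *\<^sub>C p i) \<and> (\<forall>i\<in>{1..n}. p i \<in> pos_cone)}"

end

theory Submission
  imports Defs "HOL-Computational_Algebra.Formal_Power_Series"
begin

text \<open>
  Both norms are equal to the \<open>C\<^sup>*\<close>-norm. If \<open>f\<close> is the sum of \<open>\<lambda>\<^sub>ip\<^sub>i\<close>, a state satisfies
  \<open>\<bar>s f\<bar> \<le> s (\<Sum>\<bar>\<lambda>\<^sub>i\<bar>p\<^sub>i)\<close>, and a state is bounded by the order norm on self-adjoint elements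
  (\<open>cmod_state_le_order_norm\<close>); so the minimal norm is at most the decomposition norm.
  It remains to show that the decomposition norm is at most \<open>norm f\<close> and that some state attains
  \<open>norm f\<close>. Under the Gelfand isomorphism the first would be done with a partition of unity and the
  second with point evaluations. The proof below does not construct the Gelfand spectrum; it
  replaces both tools by algebra in the positive cone.

  Partition of unity (\<open>near_optimal_decomposition\<close>). The real and imaginary parts of \<open>f\<close> are
  rescaled to lie between 0 and 1 and inserted into Bernstein polynomials. Since these reproduce
  affine functions, the products of the resulting positive elements, weighted by the nodes, sum to
  \<open>f\<close> with no error, and their second moment differs from \<open>f\<^sup>*f\<close> by a variance that tends to 0 as
  the degree grows.

  Point evaluation (\<open>norm_attaining_state_exists\<close>). Zorn's lemma gives a maximal proper
  preordering on the self-adjoint elements in which \<open>f\<^sup>*f \<ge> (norm f)\<^sup>2\<close>. It is total, the reals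
  are cofinal in it, and the Dedekind cut made by each element defines a state \<open>s\<close> that satisfies
  \<open>s (h\<^sup>2) \<le> (s h)\<^sup>2\<close> for self-adjoint \<open>h\<close>, so that \<open>\<bar>s f\<bar> \<ge> norm f\<close>.

  All of this needs the basic facts about the positive cone, in particular that it is convex and
  that \<open>r \<plusminus> h\<close> is positive for self-adjoint \<open>h\<close> with \<open>norm h \<le> r\<close>. They are derived in
  \<open>pos_cone_iff\<close> from the binomial series of the square root and the \<open>C\<^sup>*\<close>-identity for the
  unitary elements \<open>h + \<i> sqrt (1 - h\<^sup>2)\<close>.
\<close>

section \<open>The binomial series of the square root\<close>

text \<open>
  Summability at the boundary of the disc of convergence. All coefficients
  \<open>c\<^sub>n\<close> of \<open>(1 - x)\<^bsup>1/2\<^esup>\<close> with \<open>n \<ge> 1\<close> are nonpositive while every partial sum of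
  \<open>c\<^sub>0 + c\<^sub>1 + \<dots>\<close> is nonnegative, so the absolute values add up to at most 2.
\<close>

lemma abs_summable_sqrt_coeffs: "summable (\<lambda>n. \<bar>((1/2::real) gchoose n) * (-1) ^ n\<bar>)"
proof (rule summableI_nonneg_bounded)
  let ?c = "\<lambda>n. ((1/2::real) gchoose n) * (-1) ^ n"
  have c_Suc: "?c (Suc n) \<le> 0" for n
  proof -
    have "?c (Suc n) = pochhammer (- (1/2)) (Suc n) / fact (Suc n)"
      by (simp add: gbinomial_pochhammer flip: power_mult_distrib)
    also have "pochhammer (- (1/2)) (Suc n) = - (1/2) * pochhammer (1/2 :: real) n"
      by (simp add: pochhammer_rec)
    finally show ?thesis
      using pochhammer_nonneg[of "1/2::real" n] by (simp add: divide_le_0_iff)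
  qed
  have "(\<Sum>k<n. \<bar>?c k\<bar>) \<le> 2" for n
  proof (cases n)
    case (Suc m)
    have "\<bar>?c k\<bar> = (if k = 0 then 2 else 0) - ?c k" for k
      using c_Suc by (cases k) (simp_all only: abs_of_nonpos, simp_all)
    then have "(\<Sum>k\<le>m. \<bar>?c k\<bar>) = 2 - (\<Sum>k\<le>m. ?c k)"
      by (simp only: sum_subtractf) simp
    moreover have "(\<Sum>k\<le>m. ?c k) = pochhammer (1/2) m / fact m"
      by (subst gbinomial_sum_lower_neg)
        (simp add: gbinomial_pochhammer flip: power_mult_distrib)
    moreover have "pochhammer (1/2 :: real) m / fact m \<ge> 0"
      by (simp add: pochhammer_nonneg)
    ultimately show ?thesis
      by (simp only: Suc lessThan_Suc_atMost)
  qed simp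
  then show "(\<Sum>k<n. \<bar>?c k\<bar>) \<le> 2" for n .
qed simp

text \<open>
  The square root of \<open>1 - x\<close> as a power series in \<open>x\<close>; it is meant for \<open>norm x \<le> 1\<close>.
\<close>

definition sqrt_one_minus :: "'a::{real_normed_algebra_1, banach} \<Rightarrow> 'a" where
  "sqrt_one_minus x = (\<Sum>n. (((1/2) gchoose n) * (-1) ^ n) *\<^sub>R x ^ n)"

lemma summable_norm_sqrt_series:
  fixes x :: "'a::{real_normed_algebra_1, banach}"
  assumes "norm x \<le> 1"
  shows "summable (\<lambda>n. norm ((((1/2) gchoose n) * (-1) ^ n) *\<^sub>R x ^ n))"
proof (rule summable_comparison_test[OF _ abs_summable_sqrt_coeffs], intro exI allI impI)
  fix n :: nat
  have "norm (x ^ n) \<le> 1"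
    using norm_power_ineq[of x n] assms by (meson norm_ge_zero order_trans power_le_one)
  then show "norm (norm ((((1/2) gchoose n) * (-1) ^ n) *\<^sub>R x ^ n))
      \<le> \<bar>((1/2::real) gchoose n) * (-1) ^ n\<bar>"
    by (simp add: mult_left_le)
qed

lemma sqrt_one_minus_square:
  fixes x :: "'a::{real_normed_algebra_1, banach}"
  assumes "norm x \<le> 1"
  shows "sqrt_one_minus x * sqrt_one_minus x = 1 - x"
proof -
  let ?c = "\<lambda>n. ((1/2::real) gchoose n) * (-1) ^ n"
  \<comment> \<open>Vandermonde's identity: the Cauchy square of the coefficients is the expansion of
    \<open>(1 - x)\<^sup>1\<close>.\<close>
  have coeff: "(\<Sum>i\<le>n. ?c i * ?c (n - i)) = (if n = 0 then 1 else if n = 1 then -1 else 0)" for n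
  proof -
    have "(\<Sum>i\<le>n. ?c i * ?c (n - i))
        = (\<Sum>i=0..n. ((1/2) gchoose i) * ((1/2) gchoose (n - i))) * (-1) ^ n"
      unfolding sum_distrib_right atMost_atLeast0
    proof (intro sum.cong refl)
      fix i assume "i \<in> {0..n}"
      then have "(-1::real) ^ n = (-1) ^ i * (-1) ^ (n - i)"
        by (simp flip: power_add)
      then show "?c i * ?c (n - i) = ((1/2) gchoose i) * ((1/2) gchoose (n - i)) * (-1) ^ n"
        by simp
    qed
    also have "\<dots> = (of_nat 1 gchoose n) * (-1) ^ n"
      by (simp add: gbinomial_Vandermonde)
    also have "\<dots> = (if n = 0 then 1 else if n = 1 then -1 else 0)"
      by (subst binomial_gbinomial[symmetric]) (auto simp: binomial_eq_0)
    finally show ?thesis .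
  qed
  have "(\<lambda>n. \<Sum>i\<le>n. (?c i *\<^sub>R x ^ i) * (?c (n - i) *\<^sub>R x ^ (n - i)))
      sums (sqrt_one_minus x * sqrt_one_minus x)"
    unfolding sqrt_one_minus_def
    by (intro Cauchy_product_sums summable_norm_sqrt_series assms)
  also have "(\<lambda>n. \<Sum>i\<le>n. (?c i *\<^sub>R x ^ i) * (?c (n - i) *\<^sub>R x ^ (n - i)))
      = (\<lambda>n. if n \<in> {0, 1} then (if n = 0 then 1 else - x) else 0)"
  proof
    fix n
    have "(\<Sum>i\<le>n. (?c i *\<^sub>R x ^ i) * (?c (n - i) *\<^sub>R x ^ (n - i)))
        = (\<Sum>i\<le>n. (?c i * ?c (n - i)) *\<^sub>R x ^ n)"
      by (intro sum.cong refl) (simp add: mult.commute flip: power_add)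
    also have "\<dots> = (\<Sum>i\<le>n. ?c i * ?c (n - i)) *\<^sub>R x ^ n"
      by (simp only: scaleR_sum_left)
    finally show "(\<Sum>i\<le>n. (?c i *\<^sub>R x ^ i) * (?c (n - i) *\<^sub>R x ^ (n - i)))
      = (if n \<in> {0, 1} then (if n = 0 then 1 else - x) else 0)"
      unfolding coeff by simp
  qed
  finally have "(\<lambda>n. if n \<in> {0, 1} then (if n = 0 then 1 else - x) else 0)
      sums (sqrt_one_minus x * sqrt_one_minus x)" .
  moreover have "(\<lambda>n. if n \<in> {0, 1} then (if n = 0 then 1 else - x) else 0)
      sums (\<Sum>n\<in>{0, 1::nat}. if n = 0 then 1 else - x)"
    by (rule sums_If_finite_set) simp
  ultimately show ?thesis
    using sums_unique2 by fastforce
qed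

section \<open>Involution, real and imaginary parts\<close>

interpretation cstar: vector_space "scaleC :: complex \<Rightarrow> 'a::unital_cstar_algebra \<Rightarrow> 'a"
  by (rule vector_space_scaleC)

lemma adj_zero [simp]: "adj 0 = (0 :: 'a::unital_cstar_algebra)"
  using adj_add[of 0 "0::'a"] by simp

lemma adj_one [simp]: "adj 1 = (1 :: 'a::unital_cstar_algebra)"
  by (metis adj_adj adj_mult mult.right_neutral mult_1)

lemma adj_scaleR [simp]: "adj (r *\<^sub>R x) = r *\<^sub>R adj (x :: 'a::unital_cstar_algebra)"
  by (simp add: scaleR_scaleC adj_scaleC)

lemma adj_minus [simp]: "adj (- x) = - adj (x :: 'a::unital_cstar_algebra)"
  using adj_scaleR[of "-1" x] by simp

lemma adj_diff: "adj (x - y) = adj x - adj (y :: 'a::unital_cstar_algebra)"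
  using adj_add[of x "- y"] by simp

lemma adj_of_real [simp]: "adj (of_real r) = (of_real r :: 'a::unital_cstar_algebra)"
  by (simp add: of_real_def)

lemma adj_power: "adj (x ^ n) = adj (x :: 'a::unital_cstar_algebra) ^ n"
  by (induction n) (simp_all add: adj_mult power_commutes)

lemma norm_adj [simp]: "norm (adj x) = norm (x :: 'a::unital_cstar_algebra)"
proof -
  have *: "norm y \<le> norm (adj y)" for y :: 'a
  proof (cases "y = 0")
    case False
    have "norm y * norm y \<le> norm (adj y) * norm y"
      using norm_mult_ineq[of "adj y" y] by (simp add: cstar_identity power2_eq_square)
    with False show ?thesis by simp
  qed simp
  show ?thesis
    using *[of x] *[of "adj x"] by (simp add: adj_adj)
qed

lemma bounded_linear_adj: "bounded_linear (adj :: 'a::unital_cstar_algebra \<Rightarrow> 'a)"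
  by (rule bounded_linear_intro[where K = 1]) (simp_all add: adj_add)

lemma adj_sqrt_one_minus:
  fixes x :: "'a::unital_cstar_algebra"
  assumes "norm x \<le> 1" "adj x = x"
  shows "adj (sqrt_one_minus x) = sqrt_one_minus x"
  unfolding sqrt_one_minus_def
  using summable_norm_cancel[OF summable_norm_sqrt_series[OF assms(1)]] assms(2)
  by (subst bounded_linear.suminf[OF bounded_linear_adj]) (simp_all add: adj_power)

text \<open>The self-adjoint elements \<open>h\<close> and \<open>k\<close> with \<open>f = h + \<i>k\<close>.\<close>

definition re_part :: "'a::unital_cstar_algebra \<Rightarrow> 'a" where
  "re_part f = (1/2) *\<^sub>R (f + adj f)"

definition im_part :: "'a::unital_cstar_algebra \<Rightarrow> 'a" where
  "im_part f = (- \<i> / 2) *\<^sub>C (f - adj f)"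

lemma adj_re_part [simp]: "adj (re_part f) = re_part f"
  by (simp add: re_part_def adj_add adj_adj add.commute)

lemma adj_im_part [simp]: "adj (im_part f) = im_part f"
  by (simp add: im_part_def adj_scaleC adj_diff adj_adj cstar.scale_right_diff_distrib)

lemma re_im_decomposition: "re_part f + \<i> *\<^sub>C im_part f = f"
proof -
  have "\<i> *\<^sub>C im_part f = (1/2) *\<^sub>R (f - adj f)"
    by (simp add: im_part_def scaleC_scaleC scaleR_scaleC)
  then have "re_part f + \<i> *\<^sub>C im_part f = (1/2) *\<^sub>R (f + f)"
    by (simp only: re_part_def flip: scaleR_right_distrib) simp
  then show ?thesis by simp
qed

lemma norm_re_part_le: "norm (re_part f) \<le> norm f"
  using norm_triangle_ineq[of f "adj f"] by (simp add: re_part_def)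

lemma norm_im_part_le: "norm (im_part f) \<le> norm f"
  using norm_triangle_ineq4[of f "adj f"] by (simp add: im_part_def norm_scaleC norm_divide)

lemma re_im_part_unique:
  assumes "adj h = h" "adj k = k"
  shows "re_part (h + \<i> *\<^sub>C k) = h" "im_part (h + \<i> *\<^sub>C k) = k"
proof -
  have adj: "adj (h + \<i> *\<^sub>C k) = h - \<i> *\<^sub>C k"
    using assms by (simp add: adj_add adj_scaleC)
  show "re_part (h + \<i> *\<^sub>C k) = h"
    unfolding re_part_def adj by (simp add: scaleR_half_double)
  have "h + \<i> *\<^sub>C k - (h - \<i> *\<^sub>C k) = (2 * \<i>) *\<^sub>C k"
    unfolding mult_2 cstar.scale_left_distrib by simp
  then show "im_part (h + \<i> *\<^sub>C k) = k"
    unfolding im_part_def adj by (simp add: scaleC_scaleC)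
qed

lemma re_part_add: "re_part (f + g) = re_part f + re_part g"
  by (simp add: re_part_def adj_add scaleR_add_right)

lemma im_part_add: "im_part (f + g) = im_part f + im_part g"
  by (simp add: im_part_def adj_add add_diff_add cstar.scale_right_distrib)

lemma re_im_part_scaleC:
  "re_part (z *\<^sub>C f) = Re z *\<^sub>R re_part f - Im z *\<^sub>R im_part f"
  "im_part (z *\<^sub>C f) = Re z *\<^sub>R im_part f + Im z *\<^sub>R re_part f"
proof -
  define h k where hk: "h = re_part f" "k = im_part f"
  have "z *\<^sub>C f = (complex_of_real (Re z) + \<i> * complex_of_real (Im z)) *\<^sub>C (h + \<i> *\<^sub>C k)"
    by (simp only: hk re_im_decomposition flip: complex_eq)
  also have "\<dots> = (Re z *\<^sub>R h - Im z *\<^sub>R k) + \<i> *\<^sub>C (Re z *\<^sub>R k + Im z *\<^sub>R h)"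
    unfolding scaleR_scaleC cstar.scale_left_distrib cstar.scale_right_distrib scaleC_scaleC
    by (simp add: algebra_simps cstar.scale_left_distrib)
  finally have eq: "z *\<^sub>C f = (Re z *\<^sub>R h - Im z *\<^sub>R k) + \<i> *\<^sub>C (Re z *\<^sub>R k + Im z *\<^sub>R h)" .
  show "re_part (z *\<^sub>C f) = Re z *\<^sub>R re_part f - Im z *\<^sub>R im_part f"
    "im_part (z *\<^sub>C f) = Re z *\<^sub>R im_part f + Im z *\<^sub>R re_part f"
    unfolding eq hk by (subst re_im_part_unique; simp add: adj_add adj_diff)+
qed

lemma re_im_part_selfadjoint:
  assumes "adj h = h"
  shows "re_part h = h" "im_part h = 0"
  using re_im_part_unique[OF assms adj_zero] by simp_all

lemma adj_mult_self:
  fixes f :: "'a::{unital_cstar_algebra, comm_ring_1}"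
  shows "adj f * f = re_part f * re_part f + im_part f * im_part f"
proof -
  define h k where hk: "h = re_part f" "k = im_part f"
  have "adj (h + \<i> *\<^sub>C k) * (h + \<i> *\<^sub>C k) = (h - \<i> *\<^sub>C k) * (h + \<i> *\<^sub>C k)"
    by (simp add: hk adj_add adj_scaleC)
  also have "\<dots> = h * h - (\<i> *\<^sub>C k) * (\<i> *\<^sub>C k)"
    by (rule square_diff_square_factored[symmetric, of h "\<i> *\<^sub>C k", THEN trans[OF mult.commute]])
  also have "\<dots> = h * h + k * k"
    by (simp add: mult_scaleC_left mult_scaleC_right scaleC_scaleC)
  finally show ?thesis
    by (simp add: hk re_im_decomposition)
qed

section \<open>The positive cone of a commutative algebra\<close>

text \<open>
  With \<open>k\<close> a self-adjoint square root of \<open>1 - h\<^sup>2\<close>, the element \<open>u = h + \<i>k\<close> is unitary. The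
  \<open>C\<^sup>*\<close>-identity gives \<open>norm u = 1\<close>, which bounds its imaginary part \<open>k\<close> and hence
  \<open>k\<^sup>2 = 1 - h\<^sup>2\<close>.
\<close>

lemma norm_one_minus_square_le:
  fixes h :: "'a::{unital_cstar_algebra, comm_ring_1}"
  assumes "adj h = h" "norm h \<le> 1"
  shows "norm (1 - h * h) \<le> 1"
proof -
  have hh: "norm (h * h) \<le> 1" "adj (h * h) = h * h"
    using cstar_identity[of h] assms by (simp_all add: power_le_one adj_mult)
  define k where "k = sqrt_one_minus (h * h)"
  have k: "k * k = 1 - h * h" "adj k = k"
    unfolding k_def using hh by (auto intro: sqrt_one_minus_square adj_sqrt_one_minus)
  define u where "u = h + \<i> *\<^sub>C k"
  have u: "re_part u = h" "im_part u = k"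
    using re_im_part_unique[of h k] assms k by (simp_all add: u_def)
  have "(norm u)\<^sup>2 = norm (adj u * u)"
    by (simp add: cstar_identity)
  also have "\<dots> = 1"
    by (simp add: adj_mult_self u k)
  finally have "norm u = 1"
    by (simp add: power2_eq_1_iff)  (smt (verit) norm_ge_zero)
  then have "norm k \<le> 1"
    using norm_im_part_le[of u] by (simp add: u)
  moreover have "norm (1 - h * h) = (norm k)\<^sup>2"
    using cstar_identity[of k] k by simp
  ultimately show ?thesis by (simp add: power_le_one)
qed

lemma norm_diff_square_le:
  fixes h :: "'a::{unital_cstar_algebra, comm_ring_1}"
  assumes "adj h = h"
  shows "norm (of_real ((norm h)\<^sup>2) - h * h) \<le> (norm h)\<^sup>2"
proof (cases "h = 0")
  case False
  define g where "g = (1 / norm h) *\<^sub>R h"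
  have "norm (1 - g * g) \<le> 1"
    using assms False by (intro norm_one_minus_square_le) (simp_all add: g_def)
  moreover have "of_real ((norm h)\<^sup>2) - h * h = (norm h)\<^sup>2 *\<^sub>R (1 - g * g)"
    using False by (simp add: g_def of_real_def scaleR_diff_right power2_eq_square field_simps)
  ultimately show ?thesis
    by (simp add: mult_left_le)
qed simp

lemma norm_diff_le_add:
  fixes a b :: "'a::real_normed_algebra_1"
  assumes "norm (of_real t - a) \<le> t" "norm (of_real u - b) \<le> u"
  shows "norm (of_real (t + u) - (a + b)) \<le> t + u"
proof -
  have "of_real (t + u) - (a + b) = (of_real t - a) + (of_real u - b)" by simp
  then show ?thesis using assms by (simp only: norm_triangle_mono)
qed

lemma selfadjoint_sqrt_exists:
  fixes a :: "'a::unital_cstar_algebra"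
  assumes a: "adj a = a" and t: "norm (of_real t - a) \<le> t"
  obtains b where "adj b = b" "b * b = a"
proof (cases "t = 0")
  case True
  with t show ?thesis by (intro that[of 0]) simp_all
next
  case False
  have "t \<ge> 0" using t norm_ge_zero order_trans by blast
  define x where "x = (1 / t) *\<^sub>R (of_real t - a)"
  have x: "norm x \<le> 1" "adj x = x"
    using t False \<open>t \<ge> 0\<close> a by (simp_all add: x_def adj_diff)
  show ?thesis
  proof
    show "adj (sqrt t *\<^sub>R sqrt_one_minus x) = sqrt t *\<^sub>R sqrt_one_minus x"
      using x by (simp add: adj_sqrt_one_minus)
    have "(sqrt t *\<^sub>R sqrt_one_minus x) * (sqrt t *\<^sub>R sqrt_one_minus x)
        = t *\<^sub>R (sqrt_one_minus x * sqrt_one_minus x)"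
      using \<open>t \<ge> 0\<close> by simp
    also have "\<dots> = a"
      using False x by (simp add: sqrt_one_minus_square x_def scaleR_diff_right of_real_def)
    finally show "(sqrt t *\<^sub>R sqrt_one_minus x) * (sqrt t *\<^sub>R sqrt_one_minus x) = a" .
  qed
qed

text \<open>
  A description of positivity by the norm alone, without spectral theory. The condition on the
  right is visibly stable under addition, which is not clear for elements of the form \<open>b\<^sup>*b\<close>.
\<close>

lemma pos_cone_iff:
  fixes a :: "'a::{unital_cstar_algebra, comm_ring_1}"
  shows "a \<in> pos_cone \<longleftrightarrow> adj a = a \<and> (\<exists>t. norm (of_real t - a) \<le> t)"
proof
  assume "a \<in> pos_cone"
  then obtain b where b: "a = adj b * b" by (auto simp: pos_cone_def)
  then have "adj a = a" by (simp add: adj_mult adj_adj)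
  then show "adj a = a \<and> (\<exists>t. norm (of_real t - a) \<le> t)"
    unfolding b adj_mult_self
    by (metis norm_diff_le_add norm_diff_square_le adj_re_part adj_im_part)
next
  assume "adj a = a \<and> (\<exists>t. norm (of_real t - a) \<le> t)"
  then obtain t where "adj a = a" "norm (of_real t - a) \<le> t" by blast
  then obtain b where "adj b = b" "b * b = a" by (rule selfadjoint_sqrt_exists)
  then have "a = adj b * b" by simp
  then show "a \<in> pos_cone" unfolding pos_cone_def by blast
qed

context
  fixes a b :: "'a::{unital_cstar_algebra, comm_ring_1}"
begin

lemma pos_cone_adj: "a \<in> pos_cone \<Longrightarrow> adj a = a"
  by (simp add: pos_cone_iff)

lemma pos_cone_add: "a \<in> pos_cone \<Longrightarrow> b \<in> pos_cone \<Longrightarrow> a + b \<in> pos_cone"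
  unfolding pos_cone_iff by (auto simp only: adj_add intro: norm_diff_le_add)

lemma pos_cone_mult: "a \<in> pos_cone \<Longrightarrow> b \<in> pos_cone \<Longrightarrow> a * b \<in> pos_cone"
proof -
  assume "a \<in> pos_cone" "b \<in> pos_cone"
  then obtain c d where "a = adj c * c" "b = adj d * d" by (auto simp: pos_cone_def)
  then have "a * b = adj (c * d) * (c * d)"
    by (simp only: adj_mult) (simp only: mult_ac)
  then show ?thesis unfolding pos_cone_def by blast
qed

lemma pos_cone_square: "adj a = a \<Longrightarrow> a * a \<in> pos_cone"
  unfolding pos_cone_def by (auto intro!: exI[of _ a])

lemma norm_plus_mem_pos_cone: "adj a = a \<Longrightarrow> norm a \<le> r \<Longrightarrow> of_real r + a \<in> pos_cone"
  unfolding pos_cone_iff by (auto simp: adj_add intro!: exI[of _ r])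

lemma norm_minus_mem_pos_cone: "adj a = a \<Longrightarrow> norm a \<le> r \<Longrightarrow> of_real r - a \<in> pos_cone"
  unfolding pos_cone_iff by (auto simp: adj_diff intro!: exI[of _ r])

end

lemma of_real_mem_pos_cone_iff [simp]:
  "(of_real r :: 'a::{unital_cstar_algebra, comm_ring_1}) \<in> pos_cone \<longleftrightarrow> r \<ge> 0"
proof -
  have "norm (of_real t - of_real r :: 'a) = \<bar>t - r\<bar>" for t
    by (simp only: norm_of_real flip: of_real_diff)
  then show ?thesis
    by (auto simp: pos_cone_iff intro: exI[of _ r])
qed

text \<open>
  On positive elements the norm is monotone: if \<open>a = h\<^sup>2\<close> and \<open>r - a = k\<^sup>2\<close>, then
  \<open>u = h + \<i>k\<close> satisfies \<open>u\<^sup>*u = r\<close>, and \<open>h\<close> is its real part.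
\<close>

lemma norm_le_of_diff_mem_pos_cone:
  fixes a :: "'a::{unital_cstar_algebra, comm_ring_1}"
  assumes "a \<in> pos_cone" "of_real r - a \<in> pos_cone"
  shows "norm a \<le> r"
proof -
  obtain h where h: "adj h = h" "h * h = a"
    using assms(1) selfadjoint_sqrt_exists unfolding pos_cone_iff by metis
  obtain k where k: "adj k = k" "k * k = of_real r - a"
    using assms(2) selfadjoint_sqrt_exists unfolding pos_cone_iff by metis
  have "of_real r = a + (of_real r - a)" by simp
  then have "(of_real r :: 'a) \<in> pos_cone"
    using pos_cone_add[OF assms] by simp
  then have "r \<ge> 0" by simp
  have u: "re_part (h + \<i> *\<^sub>C k) = h" "im_part (h + \<i> *\<^sub>C k) = k"
    using re_im_part_unique[of h k] h k by simp_all
  have "norm a = (norm h)\<^sup>2"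
    using cstar_identity[of h] h by simp
  also have "\<dots> \<le> (norm (h + \<i> *\<^sub>C k))\<^sup>2"
    using norm_re_part_le[of "h + \<i> *\<^sub>C k"] by (simp add: u power_mono)
  also have "\<dots> = norm (of_real r :: 'a)"
    by (simp add: u h k adj_mult_self flip: cstar_identity)
  finally show ?thesis
    using \<open>r \<ge> 0\<close> by simp
qed

lemma one_mem_pos_cone [simp]: "(1 :: 'a::{unital_cstar_algebra, comm_ring_1}) \<in> pos_cone"
  and zero_mem_pos_cone [simp]: "(0 :: 'a) \<in> pos_cone"
  using of_real_mem_pos_cone_iff[of 1, where 'a='a] of_real_mem_pos_cone_iff[of 0, where 'a='a]
  by simp_all

lemma pos_cone_scaleR:
  fixes a :: "'a::{unital_cstar_algebra, comm_ring_1}"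
  shows "r \<ge> 0 \<Longrightarrow> a \<in> pos_cone \<Longrightarrow> r *\<^sub>R a \<in> pos_cone"
  by (simp add: scaleR_conv_of_real pos_cone_mult)

lemma pos_cone_sum:
  fixes p :: "'i \<Rightarrow> 'a::{unital_cstar_algebra, comm_ring_1}"
  shows "(\<And>i. i \<in> I \<Longrightarrow> p i \<in> pos_cone) \<Longrightarrow> sum p I \<in> pos_cone"
  by (induction I rule: infinite_finite_induct) (auto intro: pos_cone_add)

lemma pos_cone_power:
  fixes a :: "'a::{unital_cstar_algebra, comm_ring_1}"
  shows "a \<in> pos_cone \<Longrightarrow> a ^ n \<in> pos_cone"
  by (induction n) (auto intro: pos_cone_mult)

section \<open>The order norm\<close>

lemma order_norm_set_nonempty:
  fixes v :: "'a::{unital_cstar_algebra, comm_ring_1}"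
  assumes "adj v = v"
  shows "{r. r *\<^sub>R 1 + v \<in> pos_cone \<and> r *\<^sub>R 1 - v \<in> pos_cone} \<noteq> {}"
  using norm_plus_mem_pos_cone[OF assms order_refl] norm_minus_mem_pos_cone[OF assms order_refl]
  by (auto simp: of_real_def)

lemma order_norm_bound_nonneg:
  fixes v :: "'a::{unital_cstar_algebra, comm_ring_1}"
  assumes "r *\<^sub>R 1 + v \<in> pos_cone" "r *\<^sub>R 1 - v \<in> pos_cone"
  shows "r \<ge> 0"
proof -
  have "(r *\<^sub>R 1 + v) + (r *\<^sub>R 1 - v) = of_real (2 * r)"
    by (simp add: of_real_def scaleR_2 flip: scaleR_scaleR)
  then have "(of_real (2 * r) :: 'a) \<in> pos_cone"
    using pos_cone_add[OF assms] by simp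
  then show ?thesis
    unfolding of_real_mem_pos_cone_iff by simp
qed

lemma order_norm_le:
  fixes v :: "'a::{unital_cstar_algebra, comm_ring_1}"
  assumes "of_real r + v \<in> pos_cone" "of_real r - v \<in> pos_cone"
  shows "order_norm v \<le> r"
  unfolding order_norm_def
  using assms by (intro cInf_lower bdd_belowI[where m = 0])
    (auto simp: of_real_def intro: order_norm_bound_nonneg)

section \<open>Bernstein polynomials and near-optimal decompositions\<close>

text \<open>
  The Bernstein basis polynomials, evaluated in an arbitrary commutative ring. They form a partition
  of unity, and they are positive at positive contractions of a \<open>C\<^sup>*\<close>-algebra.
\<close>

definition bernstein_poly :: "nat \<Rightarrow> nat \<Rightarrow> 'a::comm_ring_1 \<Rightarrow> 'a" where
  "bernstein_poly n k a = of_nat (n choose k) * a ^ k * (1 - a) ^ (n - k)"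

lemma sum_bernstein_poly: "(\<Sum>k\<le>n. bernstein_poly n k a) = 1"
  using binomial_ring[of a "1 - a" n] by (simp add: bernstein_poly_def)

text \<open>
  Absorbing \<open>k\<close> into the binomial coefficient lowers the degree by one; both moments below
  follow from this identity.
\<close>

lemma sum_mult_bernstein_poly_Suc:
  fixes a :: "'a::comm_ring_1"
  shows "(\<Sum>k\<le>Suc m. of_nat k * g k * bernstein_poly (Suc m) k a)
    = of_nat (Suc m) * a * (\<Sum>k\<le>m. g (Suc k) * bernstein_poly m k a)"
proof -
  have "of_nat (Suc k) * g (Suc k) * bernstein_poly (Suc m) (Suc k) a
      = of_nat (Suc m) * a * (g (Suc k) * bernstein_poly m k a)" for k
  proof -
    have "(of_nat (Suc k) :: 'a) * of_nat (Suc m choose Suc k) = of_nat (Suc m) * of_nat (m choose k)"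
      by (simp only: Suc_times_binomial flip: of_nat_mult)
    then have "(of_nat (Suc k) * of_nat (Suc m choose Suc k)) * (g (Suc k) * a * a ^ k * (1 - a) ^ (m - k))
      = (of_nat (Suc m) * of_nat (m choose k)) * (g (Suc k) * a * a ^ k * (1 - a) ^ (m - k))"
      by (rule arg_cong)
    then show ?thesis
      unfolding bernstein_poly_def by (simp only: power_Suc diff_Suc_Suc mult_ac)
  qed
  then show ?thesis
    by (simp only: sum.atMost_Suc_shift sum_distrib_left) simp
qed

lemma sum_of_nat_bernstein_poly:
  "(\<Sum>k\<le>Suc m. of_nat k * bernstein_poly (Suc m) k a) = of_nat (Suc m) * a"
  using sum_mult_bernstein_poly_Suc[where g = "\<lambda>_. 1" and m = m and a = a]
  by (simp only: sum_bernstein_poly mult_1_left mult_1_right)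

lemma sum_of_nat_square_bernstein_poly:
  "(\<Sum>k\<le>Suc m. of_nat k * of_nat k * bernstein_poly (Suc m) k a)
    = of_nat (Suc m) * a * (1 + of_nat m * a)"
proof -
  have "(\<Sum>k\<le>m. of_nat (Suc k) * bernstein_poly m k a) = 1 + of_nat m * a"
  proof (cases m)
    case (Suc l)
    have "(\<Sum>k\<le>m. of_nat (Suc k) * bernstein_poly m k a)
        = (\<Sum>k\<le>m. bernstein_poly m k a) + (\<Sum>k\<le>m. of_nat k * bernstein_poly m k a)"
      by (simp only: of_nat_Suc distrib_right mult_1_left sum.distrib)
    then show ?thesis
      unfolding Suc sum_of_nat_bernstein_poly sum_bernstein_poly .
  qed (simp add: bernstein_poly_def)
  then show ?thesis
    by (simp only: sum_mult_bernstein_poly_Suc)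
qed

lemma bernstein_poly_mem_pos_cone:
  fixes a :: "'a::{unital_cstar_algebra, comm_ring_1}"
  assumes "a \<in> pos_cone" "1 - a \<in> pos_cone"
  shows "bernstein_poly n k a \<in> pos_cone"
proof -
  have "(of_nat (n choose k) :: 'a) = of_real (real (n choose k))"
    by simp
  then have "(of_nat (n choose k) :: 'a) \<in> pos_cone"
    by (simp only: of_real_mem_pos_cone_iff of_nat_0_le_iff)
  then show ?thesis
    unfolding bernstein_poly_def by (intro pos_cone_mult pos_cone_power assms)
qed

text \<open>
  An approximate spectral resolution of a self-adjoint element \<open>x\<close>, with positive weights
  \<open>p\<^sub>k\<close> at real nodes \<open>t\<^sub>k\<close>. Pointwise on the spectrum the weights form a probability
  distribution with mean exactly \<open>x\<close> and variance \<open>(c\<^sup>2 - x\<^sup>2) / (m + 1)\<close>: the binomial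
  distribution, rescaled to the interval from \<open>- c\<close> to \<open>c\<close>.
\<close>

lemma discrete_resolution:
  fixes x :: "'a::{unital_cstar_algebra, comm_ring_1}"
  assumes x: "adj x = x" "norm x \<le> c" and c: "c > 0"
  obtains t :: "nat \<Rightarrow> real" and p :: "nat \<Rightarrow> 'a"
  where "\<And>k. p k \<in> pos_cone" "(\<Sum>k\<le>Suc m. p k) = 1" "(\<Sum>k\<le>Suc m. t k *\<^sub>R p k) = x"
    "(\<Sum>k\<le>Suc m. (t k)\<^sup>2 *\<^sub>R p k) = x * x + (1 / Suc m) *\<^sub>R (of_real (c\<^sup>2) - x * x)"
proof
  define a where "a = (1 / (2 * c)) *\<^sub>R (of_real c + x)"
  define t where "t = (\<lambda>k. c * (2 * real k / Suc m - 1))"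
  have x_eq: "x = (2 * c) *\<^sub>R a - of_real c"
    using c by (simp add: a_def)
  have "of_real c - x = (2 * c) *\<^sub>R (1 - a)"
    unfolding x_eq of_real_def mult_2 scaleR_diff_right scaleR_left_distrib by simp
  then have "1 - a = (1 / (2 * c)) *\<^sub>R (of_real c - x)"
    using c by simp
  then have pos: "a \<in> pos_cone" "1 - a \<in> pos_cone"
    using norm_plus_mem_pos_cone[OF x] norm_minus_mem_pos_cone[OF x] c
    by (simp_all add: a_def pos_cone_scaleR)
  show "bernstein_poly (Suc m) k a \<in> pos_cone" for k
    using pos by (rule bernstein_poly_mem_pos_cone)
  show sum1: "(\<Sum>k\<le>Suc m. bernstein_poly (Suc m) k a) = 1"
    by (rule sum_bernstein_poly)
  \<comment> \<open>The first two moments of the binomial distribution with parameter \<open>a\<close>.\<close>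
  define S1 S2 where "S1 = (\<Sum>k\<le>Suc m. real k *\<^sub>R bernstein_poly (Suc m) k a)"
    and "S2 = (\<Sum>k\<le>Suc m. (real k)\<^sup>2 *\<^sub>R bernstein_poly (Suc m) k a)"
  have S1: "S1 = real (Suc m) *\<^sub>R a"
    using sum_of_nat_bernstein_poly[of m a] unfolding S1_def
    by (simp only: scaleR_conv_of_real of_real_of_nat_eq)
  have S2: "S2 = real (Suc m) *\<^sub>R (a + real m *\<^sub>R (a * a))"
    using sum_of_nat_square_bernstein_poly[of m a] unfolding S2_def
    by (simp only: scaleR_conv_of_real of_real_of_nat_eq power2_eq_square of_real_mult
        distrib_left mult_1_right mult_1_left mult_ac)
  have "(\<Sum>k\<le>Suc m. t k *\<^sub>R bernstein_poly (Suc m) k a)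
      = (\<Sum>k\<le>Suc m. (2 * c / Suc m) *\<^sub>R (real k *\<^sub>R bernstein_poly (Suc m) k a)
          - c *\<^sub>R bernstein_poly (Suc m) k a)"
    by (intro sum.cong refl) (simp add: t_def scaleR_diff_left right_diff_distrib mult_ac)
  also have "\<dots> = (2 * c / Suc m) *\<^sub>R S1 - of_real c"
    unfolding S1_def sum_subtractf scaleR_sum_right[symmetric] sum1 of_real_def ..
  also have "\<dots> = x"
    unfolding S1 x_eq by (simp del: of_nat_Suc)
  finally show "(\<Sum>k\<le>Suc m. t k *\<^sub>R bernstein_poly (Suc m) k a) = x" .
  have "(\<Sum>k\<le>Suc m. (t k)\<^sup>2 *\<^sub>R bernstein_poly (Suc m) k a)
      = (\<Sum>k\<le>Suc m. (4 * c\<^sup>2 / (real (Suc m))\<^sup>2) *\<^sub>R ((real k)\<^sup>2 *\<^sub>R bernstein_poly (Suc m) k a)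
          - (4 * c\<^sup>2 / Suc m) *\<^sub>R (real k *\<^sub>R bernstein_poly (Suc m) k a)
          + c\<^sup>2 *\<^sub>R bernstein_poly (Suc m) k a)"
  proof (intro sum.cong refl)
    fix k
    have "(t k)\<^sup>2 = (4 * c\<^sup>2 / (real (Suc m))\<^sup>2) * (real k)\<^sup>2 - (4 * c\<^sup>2 / Suc m) * real k + c\<^sup>2"
      unfolding t_def by (simp add: power2_eq_square field_simps del: of_nat_Suc)
    then show "(t k)\<^sup>2 *\<^sub>R bernstein_poly (Suc m) k a
      = (4 * c\<^sup>2 / (real (Suc m))\<^sup>2) *\<^sub>R ((real k)\<^sup>2 *\<^sub>R bernstein_poly (Suc m) k a)
          - (4 * c\<^sup>2 / Suc m) *\<^sub>R (real k *\<^sub>R bernstein_poly (Suc m) k a)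
          + c\<^sup>2 *\<^sub>R bernstein_poly (Suc m) k a"
      by (simp only: scaleR_add_left scaleR_diff_left scaleR_scaleR)
  qed
  also have "\<dots> = (4 * c\<^sup>2 / (real (Suc m))\<^sup>2) *\<^sub>R S2 - (4 * c\<^sup>2 / Suc m) *\<^sub>R S1 + of_real (c\<^sup>2)"
    unfolding S1_def S2_def sum.distrib sum_subtractf scaleR_sum_right[symmetric] sum1 of_real_def ..
  also have "\<dots> = (4 * c\<^sup>2 / Suc m) *\<^sub>R (a + real m *\<^sub>R (a * a)) - (4 * c\<^sup>2) *\<^sub>R a + of_real (c\<^sup>2)"
    unfolding S1 S2 by (simp add: power2_eq_square del: of_nat_Suc)
  also have "\<dots> = x * x + (1 / Suc m) *\<^sub>R (of_real (c\<^sup>2) - x * x)"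
  proof -
    define d where "d = real (Suc m)"
    have d: "d \<noteq> 0" "real m = d - 1" by (simp_all add: d_def)
    have xx: "x * x = (4 * c\<^sup>2) *\<^sub>R (a * a) - (4 * c\<^sup>2) *\<^sub>R a + of_real (c\<^sup>2)"
      unfolding x_eq scaleR_conv_of_real by (simp add: algebra_simps power2_eq_square)
    have e: "(4 * c\<^sup>2 / d) * (d - 1) = 4 * c\<^sup>2 - (4 * c\<^sup>2 / d)"
      using d by (simp add: field_simps)
    show ?thesis
      unfolding xx d_def[symmetric] d(2) scaleR_add_right scaleR_diff_right scaleR_scaleR e
      using d(1) by (simp add: scaleR_diff_left)
  qed
  finally show "(\<Sum>k\<le>Suc m. (t k)\<^sup>2 *\<^sub>R bernstein_poly (Suc m) k a)
    = x * x + (1 / Suc m) *\<^sub>R (of_real (c\<^sup>2) - x * x)" .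
qed

text \<open>
  The two-dimensional version, with real part resolved by \<open>p\<^sub>k\<close> and imaginary part by \<open>q\<^sub>l\<close>,
  writes \<open>f\<close> exactly as the combination of the positive elements \<open>p\<^sub>kq\<^sub>l\<close> with coefficients
  \<open>z\<^sub>k\<^sub>l = t\<^sub>k + \<i>u\<^sub>l\<close>. Its second absolute moment is \<open>f\<^sup>*f\<close> up to a small variance, and
  \<open>2c\<bar>z\<bar> \<le> c\<^sup>2 + \<bar>z\<bar>\<^sup>2\<close> turns this into a bound on the first absolute moment.
\<close>

lemma near_optimal_decomposition:
  fixes f :: "'a::{unital_cstar_algebra, comm_ring_1}"
  assumes c: "norm f < c"
  obtains n :: nat and l p where "f = (\<Sum>i=1..n. l i *\<^sub>C p i)" "\<And>i. i \<in> {1..n} \<Longrightarrow> p i \<in> pos_cone"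
    "order_norm (\<Sum>i=1..n. cmod (l i) *\<^sub>R p i) \<le> c"
proof -
  define x y where "x = re_part f" and "y = im_part f"
  have c: "c > 0" "norm f < c"
    using c norm_ge_zero le_less_trans by blast+
  have "adj x = x" "norm x \<le> c" "adj y = y" "norm y \<le> c"
    using norm_re_part_le[of f] norm_im_part_le[of f] c by (simp_all add: x_def y_def)
  have ff: "x * x + y * y = adj f * f"
    by (simp add: x_def y_def adj_mult_self)
  have gap: "c\<^sup>2 - (norm f)\<^sup>2 > 0"
    using c by (simp add: power_strict_mono)
  \<comment> \<open>The degree is chosen so large that the variance fits into the gap.\<close>
  obtain m where m: "inverse (real (Suc m)) < (c\<^sup>2 - (norm f)\<^sup>2) / (2 * c\<^sup>2)"
    using reals_Archimedean[of "(c\<^sup>2 - (norm f)\<^sup>2) / (2 * c\<^sup>2)"] gap c by auto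
  define d where "d = 1 / real (Suc m)"
  have d: "d > 0" "c\<^sup>2 - (norm f)\<^sup>2 - 2 * d * c\<^sup>2 \<ge> 0"
    using m c by (simp_all add: d_def field_simps)
  obtain t p where p: "\<And>k. p k \<in> pos_cone" "(\<Sum>k\<le>Suc m. p k) = 1" "(\<Sum>k\<le>Suc m. t k *\<^sub>R p k) = x"
      "(\<Sum>k\<le>Suc m. (t k)\<^sup>2 *\<^sub>R p k) = x * x + d *\<^sub>R (of_real (c\<^sup>2) - x * x)"
    by (rule discrete_resolution[OF \<open>adj x = x\<close> \<open>norm x \<le> c\<close> \<open>c > 0\<close>, of m, folded d_def]) (rule that)
  obtain u q where q: "\<And>k. q k \<in> pos_cone" "(\<Sum>k\<le>Suc m. q k) = 1" "(\<Sum>k\<le>Suc m. u k *\<^sub>R q k) = y"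
      "(\<Sum>k\<le>Suc m. (u k)\<^sup>2 *\<^sub>R q k) = y * y + d *\<^sub>R (of_real (c\<^sup>2) - y * y)"
    by (rule discrete_resolution[OF \<open>adj y = y\<close> \<open>norm y \<le> c\<close> \<open>c > 0\<close>, of m, folded d_def]) (rule that)
  define I where "I = {..Suc m} \<times> {..Suc m}"
  define z where "z = (\<lambda>(k, l). Complex (t k) (u l))"
  define w where "w = (\<lambda>(k, l). p k * q l)"
  have w_pos: "w i \<in> pos_cone" for i
    by (simp add: w_def p q pos_cone_mult split: prod.split)
  have sum_left: "(\<Sum>(k, l)\<in>I. g k *\<^sub>R w (k, l)) = (\<Sum>k\<le>Suc m. g k *\<^sub>R p k)" for g :: "nat \<Rightarrow> real"
    using sum_product[of "\<lambda>k. g k *\<^sub>R p k" "{..Suc m}" q "{..Suc m}"]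
    unfolding q(2) I_def w_def sum.cartesian_product[symmetric] by simp
  have sum_right: "(\<Sum>(k, l)\<in>I. g l *\<^sub>R w (k, l)) = (\<Sum>l\<le>Suc m. g l *\<^sub>R q l)" for g :: "nat \<Rightarrow> real"
    using sum_product[of p "{..Suc m}" "\<lambda>l. g l *\<^sub>R q l" "{..Suc m}"]
    unfolding p(2) I_def w_def sum.cartesian_product[symmetric] by simp
  have sum_w: "(\<Sum>i\<in>I. w i) = 1"
    using sum_left[of "\<lambda>_. 1"] p(2) by (simp add: case_prod_unfold)
  have f_eq: "f = (\<Sum>i\<in>I. z i *\<^sub>C w i)"
  proof -
    have "z i *\<^sub>C w i = t (fst i) *\<^sub>R w i + \<i> *\<^sub>C (u (snd i) *\<^sub>R w i)" for i
      by (cases i) (simp add: z_def Complex_eq scaleR_scaleC scaleC_scaleC cstar.scale_left_distrib)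
    then have "(\<Sum>i\<in>I. z i *\<^sub>C w i)
        = (\<Sum>i\<in>I. t (fst i) *\<^sub>R w i) + \<i> *\<^sub>C (\<Sum>i\<in>I. u (snd i) *\<^sub>R w i)"
      by (simp only: sum.distrib cstar.scale_sum_right)
    also have "\<dots> = x + \<i> *\<^sub>C y"
      using sum_left[of t] sum_right[of u] p(3) q(3) by (simp add: case_prod_unfold)
    finally show ?thesis
      by (simp add: x_def y_def re_im_decomposition)
  qed
  define v where "v = (\<Sum>i\<in>I. cmod (z i) *\<^sub>R w i)"
  have v_pos: "v \<in> pos_cone"
    unfolding v_def by (intro pos_cone_sum pos_cone_scaleR w_pos) simp
  have sum_sq: "(\<Sum>i\<in>I. (cmod (z i))\<^sup>2 *\<^sub>R w i)
      = adj f * f + d *\<^sub>R (of_real (2 * c\<^sup>2) - adj f * f)"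
  proof -
    have "(cmod (z i))\<^sup>2 *\<^sub>R w i = (t (fst i))\<^sup>2 *\<^sub>R w i + (u (snd i))\<^sup>2 *\<^sub>R w i" for i
      by (cases i) (simp add: z_def cmod_power2 scaleR_left_distrib)
    then have "(\<Sum>i\<in>I. (cmod (z i))\<^sup>2 *\<^sub>R w i)
        = (\<Sum>i\<in>I. (t (fst i))\<^sup>2 *\<^sub>R w i) + (\<Sum>i\<in>I. (u (snd i))\<^sup>2 *\<^sub>R w i)"
      by (simp only: sum.distrib)
    also have "\<dots> = (x * x + d *\<^sub>R (of_real (c\<^sup>2) - x * x)) + (y * y + d *\<^sub>R (of_real (c\<^sup>2) - y * y))"
      using sum_left[of "\<lambda>k. (t k)\<^sup>2"] sum_right[of "\<lambda>l. (u l)\<^sup>2"] p(4) q(4)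
      by (simp add: case_prod_unfold)
    also have "\<dots> = (x * x + y * y) + d *\<^sub>R (of_real (2 * c\<^sup>2) - (x * x + y * y))"
      unfolding mult_2 of_real_add scaleR_diff_right scaleR_add_right by simp
    finally show ?thesis
      by (simp only: ff)
  qed
  have "of_real c - v \<in> pos_cone"
  proof -
    define r where "r = (\<Sum>i\<in>I. (c - cmod (z i))\<^sup>2 *\<^sub>R w i)"
    have r_pos: "r \<in> pos_cone"
      unfolding r_def by (intro pos_cone_sum pos_cone_scaleR w_pos) simp
    have "(c - cmod (z i))\<^sup>2 *\<^sub>R w i
        = c\<^sup>2 *\<^sub>R w i - (2 * c) *\<^sub>R (cmod (z i) *\<^sub>R w i) + (cmod (z i))\<^sup>2 *\<^sub>R w i" for i
      by (simp add: power2_diff scaleR_diff_left scaleR_add_left)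
    then have r_eq: "r = of_real (c\<^sup>2) - (2 * c) *\<^sub>R v + (\<Sum>i\<in>I. (cmod (z i))\<^sup>2 *\<^sub>R w i)"
      by (simp only: r_def v_def sum.distrib sum_subtractf sum_w of_real_def flip: scaleR_sum_right)
    have ff_le: "of_real ((norm f)\<^sup>2) - adj f * f \<in> pos_cone"
      by (rule norm_minus_mem_pos_cone) (simp_all add: adj_mult adj_adj cstar_identity)
    have ff_pos: "adj f * f \<in> pos_cone"
      unfolding pos_cone_def by blast
    have "(2 * c) *\<^sub>R (of_real c - v)
        = r + (of_real ((norm f)\<^sup>2) - adj f * f) + d *\<^sub>R (adj f * f)
          + of_real (c\<^sup>2 - (norm f)\<^sup>2 - 2 * d * c\<^sup>2)"
      unfolding r_eq sum_sq
      by (simp add: scaleR_conv_of_real algebra_simps power2_eq_square)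
    also have "\<dots> \<in> pos_cone"
      using d by (intro pos_cone_add pos_cone_scaleR r_pos ff_le ff_pos
          iffD2[OF of_real_mem_pos_cone_iff]) simp_all
    finally have "(2 * c) *\<^sub>R (of_real c - v) \<in> pos_cone" .
    then have "(1 / (2 * c)) *\<^sub>R (2 * c) *\<^sub>R (of_real c - v) \<in> pos_cone"
      using c by (intro pos_cone_scaleR[of "1 / (2 * c)"]) simp_all
    moreover have "(1 / (2 * c)) *\<^sub>R (2 * c) *\<^sub>R (of_real c - v) = of_real c - v"
      using c by (simp only: scaleR_scaleR) simp
    ultimately show ?thesis
      by (simp only:)
  qed
  moreover have "of_real c + v \<in> pos_cone"
    using c v_pos by (intro pos_cone_add) simp_all
  ultimately have "order_norm v \<le> c"
    by (rule order_norm_le[rotated])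
  have "finite I"
    by (simp add: I_def)
  then obtain g where g: "bij_betw g {1..card I} I"
    using ex_bij_betw_nat_finite_1 by blast
  show thesis
  proof (rule that)
    show "f = (\<Sum>i=1..card I. z (g i) *\<^sub>C w (g i))"
      by (subst f_eq) (rule sum.reindex_bij_betw[OF g, symmetric])
    have "v = (\<Sum>i=1..card I. cmod (z (g i)) *\<^sub>R w (g i))"
      unfolding v_def by (rule sum.reindex_bij_betw[OF g, symmetric])
    then show "order_norm (\<Sum>i=1..card I. cmod (z (g i)) *\<^sub>R w (g i)) \<le> c"
      using \<open>order_norm v \<le> c\<close> by simp
  qed (rule w_pos)
qed

section \<open>Maximal preorderings\<close>

text \<open>
  Proper preorderings in the sense of real algebra, on the ring of self-adjoint elements: sets that
  contain all positive elements, are closed under sums and products, and do not contain \<open>- 1\<close>.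
\<close>

definition proper_preordering :: "'a::{unital_cstar_algebra, comm_ring_1} set \<Rightarrow> bool" where
  "proper_preordering Q \<longleftrightarrow> Q \<subseteq> {h. adj h = h} \<and> pos_cone \<subseteq> Q \<and>
     (\<forall>a\<in>Q. \<forall>b\<in>Q. a + b \<in> Q \<and> a * b \<in> Q) \<and> - 1 \<notin> Q"

lemma proper_preordering_pos_cone: "proper_preordering pos_cone"
  using of_real_mem_pos_cone_iff[of "-1", where 'a='a]
  by (auto simp: proper_preordering_def pos_cone_adj intro: pos_cone_add pos_cone_mult)

text \<open>The enlarged preordering consists of all \<open>a + hb\<close> with \<open>a\<close> and \<open>b\<close> in \<open>Q\<close>.\<close>

lemma preordering_adjoin:
  fixes Q :: "'a::{unital_cstar_algebra, comm_ring_1} set"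
  assumes Q: "proper_preordering Q" and h: "adj h = h"
    and proper: "\<And>a b. a \<in> Q \<Longrightarrow> b \<in> Q \<Longrightarrow> a + h * b \<noteq> - 1"
  obtains R where "proper_preordering R" "Q \<subseteq> R" "h \<in> R"
proof
  define R where "R = {a + h * b | a b. a \<in> Q \<and> b \<in> Q}"
  have Q_closed: "a + b \<in> Q" "a * b \<in> Q" if "a \<in> Q" "b \<in> Q" for a b
    using Q that by (auto simp: proper_preordering_def)
  have sa: "adj a = a" if "a \<in> Q" for a
    using Q that by (auto simp: proper_preordering_def)
  have pos: "pos_cone \<subseteq> Q"
    using Q by (simp add: proper_preordering_def)
  then have zero: "0 \<in> Q" and one: "1 \<in> Q" and hh: "h * h \<in> Q"
    using pos_cone_square[OF h] by auto
  have RI: "a + h * b \<in> R" if "a \<in> Q" "b \<in> Q" for a b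
    using that by (auto simp: R_def)
  show "Q \<subseteq> R"
    using RI[OF _ zero] by auto
  show "h \<in> R"
    using RI[OF zero one] by simp
  have "x + y \<in> R \<and> x * y \<in> R" if in_R: "x \<in> R" "y \<in> R" for x y
  proof -
    obtain a b c d where abcd: "a \<in> Q" "b \<in> Q" "c \<in> Q" "d \<in> Q"
      and xy: "x = a + h * b" "y = c + h * d"
      using in_R unfolding R_def by blast
    have "x + y = (a + c) + h * (b + d)"
      "x * y = (a * c + (h * h) * (b * d)) + h * (a * d + b * c)"
      by (simp_all add: xy algebra_simps)
    then show ?thesis
      using abcd hh by (auto intro!: RI Q_closed)
  qed
  moreover have "R \<subseteq> {h. adj h = h}"
    using sa h by (auto simp: R_def adj_add adj_mult mult.commute)
  moreover have "- 1 \<notin> R"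
    using proper by (fastforce simp: R_def)
  ultimately show "proper_preordering R"
    using pos \<open>Q \<subseteq> R\<close> by (auto simp: proper_preordering_def)
qed

lemma maximal_preordering_exists:
  assumes "proper_preordering Q"
  obtains M where "proper_preordering M" "Q \<subseteq> M" "\<And>R. proper_preordering R \<Longrightarrow> M \<subseteq> R \<Longrightarrow> R = M"
proof -
  define \<A> where "\<A> = {R. proper_preordering R \<and> Q \<subseteq> R}"
  have "\<exists>M\<in>\<A>. \<forall>X\<in>\<A>. M \<subseteq> X \<longrightarrow> X = M"
  proof (rule subset_Zorn_nonempty)
    show "\<A> \<noteq> {}"
      using assms by (auto simp: \<A>_def)
  next
    fix C assume C: "C \<noteq> {}" "subset.chain \<A> C"
    then have mem: "proper_preordering R" "Q \<subseteq> R" if "R \<in> C" for R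
      using that by (auto simp: \<A>_def subset_chain_def)
    have "a + b \<in> \<Union>C \<and> a * b \<in> \<Union>C" if ab: "a \<in> \<Union>C" "b \<in> \<Union>C" for a b
    proof -
      obtain A B where AB: "A \<in> C" "a \<in> A" "B \<in> C" "b \<in> B"
        using ab by blast
      then have "A \<subseteq> B \<or> B \<subseteq> A"
        using C(2) by (auto simp: subset_chain_def)
      then obtain D where "D \<in> C" "a \<in> D" "b \<in> D"
        using AB by blast
      moreover from this have "a + b \<in> D" "a * b \<in> D"
        using mem(1)[of D] by (auto simp: proper_preordering_def)
      ultimately show ?thesis
        by blast
    qed
    moreover have "\<Union>C \<subseteq> {h. adj h = h}" "- 1 \<notin> \<Union>C" "pos_cone \<subseteq> \<Union>C" "Q \<subseteq> \<Union>C"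
      using mem C(1) by (fastforce simp: proper_preordering_def)+
    ultimately show "\<Union>C \<in> \<A>"
      by (simp add: \<A>_def proper_preordering_def)
  qed
  then obtain M where M: "M \<in> \<A>" and max: "\<And>X. X \<in> \<A> \<Longrightarrow> M \<subseteq> X \<Longrightarrow> X = M"
    by blast
  show thesis
  proof (rule that)
    show "proper_preordering M" "Q \<subseteq> M"
      using M by (auto simp: \<A>_def)
    fix R assume "proper_preordering R" "M \<subseteq> R"
    with M show "R = M"
      by (intro max) (auto simp: \<A>_def)
  qed
qed

text \<open>
  If neither \<open>h\<close> nor \<open>- h\<close> can be adjoined, then \<open>- hb = 1 + a\<close> and \<open>hd = 1 + c\<close> with
  \<open>a, b, c, d\<close> in \<open>M\<close>; multiplying the two equations exhibits \<open>- 1\<close> as a member of \<open>M\<close>.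
\<close>

lemma maximal_preordering_total:
  fixes M :: "'a::{unital_cstar_algebra, comm_ring_1} set"
  assumes M: "proper_preordering M" and max: "\<And>R. proper_preordering R \<Longrightarrow> M \<subseteq> R \<Longrightarrow> R = M"
    and h: "adj h = h"
  shows "h \<in> M \<or> - h \<in> M"
proof (rule ccontr)
  assume not: "\<not> (h \<in> M \<or> - h \<in> M)"
  have M_closed: "a + b \<in> M" "a * b \<in> M" if "a \<in> M" "b \<in> M" for a b
    using M that by (auto simp: proper_preordering_def)
  have hh: "h * h \<in> M"
    using M pos_cone_square[OF h] by (auto simp: proper_preordering_def)
  obtain a b where ab: "a \<in> M" "b \<in> M" "a + h * b = - 1"
    using preordering_adjoin[OF M h] max not by metis
  obtain c d where cd: "c \<in> M" "d \<in> M" "c + (- h) * d = - 1"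
    using preordering_adjoin[OF M, of "- h"] h max not by (metis adj_minus)
  have "h * b = - (1 + a)" "h * d = 1 + c"
    using ab cd by (simp_all add: algebra_simps eq_neg_iff_add_eq_0)
  then have "(h * h) * (b * d) = - (1 + a) * (1 + c)"
    by (metis mult.assoc mult.left_commute)
  then have "a + c + a * c + (h * h) * (b * d) = - 1"
    by (simp add: algebra_simps)
  moreover have "a + c + a * c + (h * h) * (b * d) \<in> M"
    using ab(1,2) cd(1,2) by (intro M_closed(1) M_closed(2)[OF hh] M_closed(2)[of a c] M_closed(2)[of b d])
  ultimately show False
    using M by (simp add: proper_preordering_def)
qed

section \<open>Dedekind cuts in a preordering\<close>

text \<open>
  The self-adjoint element \<open>h\<close> has the real value \<open>t\<close> with respect to the order given by \<open>Q\<close>,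
  up to infinitesimals: \<open>t - e \<le> h \<le> t + e\<close> for every real \<open>e > 0\<close>. This is a relation;
  \<open>cut_unique\<close> and, for total orders, \<open>cut_exists\<close> make it a function.
\<close>

definition cut :: "'a::{unital_cstar_algebra, comm_ring_1} set \<Rightarrow> 'a \<Rightarrow> real \<Rightarrow> bool" where
  "cut Q h t \<longleftrightarrow> (\<forall>e>0. h - of_real (t - e) \<in> Q \<and> of_real (t + e) - h \<in> Q)"

lemma cutI:
  assumes "\<And>e. e > 0 \<Longrightarrow> h - of_real (t - e) \<in> Q" "\<And>e. e > 0 \<Longrightarrow> of_real (t + e) - h \<in> Q"
  shows "cut Q h t"
  using assms by (simp add: cut_def)

lemma cutD:
  assumes "cut Q h t" "e > 0"
  shows "h - of_real (t - e) \<in> Q" "of_real (t + e) - h \<in> Q"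
  using assms by (auto simp: cut_def)

context
  fixes Q :: "'a::{unital_cstar_algebra, comm_ring_1} set"
  assumes Q: "proper_preordering Q"
begin

lemma preordering_add: "a \<in> Q \<Longrightarrow> b \<in> Q \<Longrightarrow> a + b \<in> Q"
  and preordering_mult: "a \<in> Q \<Longrightarrow> b \<in> Q \<Longrightarrow> a * b \<in> Q"
  and preordering_adj: "a \<in> Q \<Longrightarrow> adj a = a"
  and pos_cone_subset_preordering: "a \<in> pos_cone \<Longrightarrow> a \<in> Q"
  using Q by (auto simp: proper_preordering_def)

lemma of_real_mem_preordering_iff: "of_real r \<in> Q \<longleftrightarrow> r \<ge> 0"
proof
  assume r: "of_real r \<in> Q"
  show "r \<ge> 0"
  proof (rule ccontr)
    assume "\<not> r \<ge> 0"
    then have "(of_real (- 1 / r) :: 'a) \<in> Q"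
      by (intro pos_cone_subset_preordering iffD2[OF of_real_mem_pos_cone_iff])
        (simp add: field_simps)
    then have "of_real (- 1 / r) * of_real r \<in> Q"
      using r by (rule preordering_mult)
    also have "of_real (- 1 / r) * of_real r = (of_real (- 1) :: 'a)"
      using \<open>\<not> r \<ge> 0\<close> unfolding of_real_mult[symmetric] by simp
    finally show False
      using Q by (simp add: proper_preordering_def)
  qed
qed (simp add: pos_cone_subset_preordering)

lemma preordering_scaleR: "r \<ge> 0 \<Longrightarrow> a \<in> Q \<Longrightarrow> r *\<^sub>R a \<in> Q"
  by (simp add: scaleR_conv_of_real preordering_mult of_real_mem_preordering_iff)

lemma cut_le:
  assumes "cut Q h s" "cut Q k t" "k - h \<in> Q"
  shows "s \<le> t"
proof (rule field_le_epsilon)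
  fix e :: real
  assume "e > 0"
  then have "(h - of_real (s - e / 2)) + (of_real (t + e / 2) - k) + (k - h) \<in> Q"
    using assms by (intro preordering_add cutD) simp_all
  also have "(h - of_real (s - e / 2)) + (of_real (t + e / 2) - k) + (k - h)
      = of_real ((t + e / 2) - (s - e / 2))"
    by (simp only: of_real_diff) simp
  finally show "s \<le> t + e"
    unfolding of_real_mem_preordering_iff by simp
qed

lemma cut_unique: "cut Q h s \<Longrightarrow> cut Q h t \<Longrightarrow> s = t"
  using cut_le[of h s h t] cut_le[of h t h s] of_real_mem_preordering_iff[of 0] by simp

lemma cut_add:
  assumes "cut Q h s" "cut Q k t"
  shows "cut Q (h + k) (s + t)"
proof (rule cutI)
  fix e :: real
  assume "e > 0"
  then obtain d where d: "d > 0" "e = d + d"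
    using field_sum_of_halves[of e] half_gt_zero by metis
  have "(h + k) - of_real (s + t - e) = (h - of_real (s - d)) + (k - of_real (t - d))"
    "of_real (s + t + e) - (h + k) = (of_real (s + d) - h) + (of_real (t + d) - k)"
    unfolding d by simp_all
  then show "(h + k) - of_real (s + t - e) \<in> Q" "of_real (s + t + e) - (h + k) \<in> Q"
    using cutD[OF assms(1) d(1)] cutD[OF assms(2) d(1)] by (simp_all only: preordering_add)
qed

lemma cut_minus:
  assumes "cut Q h t"
  shows "cut Q (- h) (- t)"
  using cutD[OF assms] by (intro cutI) (simp_all add: algebra_simps)

lemma cut_of_real: "cut Q (of_real r) r"
  unfolding cut_def of_real_diff[symmetric] of_real_mem_preordering_iff by simp

lemma cut_scaleR_pos:
  assumes "cut Q h t" "r > 0"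
  shows "cut Q (r *\<^sub>R h) (r * t)"
proof (rule cutI)
  fix e :: real
  assume "e > 0"
  then have e: "e / r > 0" using \<open>r > 0\<close> by simp
  have "r *\<^sub>R h - of_real (r * t - e) = r *\<^sub>R (h - of_real (t - e / r))"
    "of_real (r * t + e) - r *\<^sub>R h = r *\<^sub>R (of_real (t + e / r) - h)"
    using \<open>r > 0\<close> by (simp_all add: of_real_def scaleR_diff_right algebra_simps)
  then show "r *\<^sub>R h - of_real (r * t - e) \<in> Q" "of_real (r * t + e) - r *\<^sub>R h \<in> Q"
    using cutD[OF assms(1) e] \<open>r > 0\<close> by (simp_all add: preordering_scaleR)
qed

lemma cut_scaleR:
  assumes "cut Q h t"
  shows "cut Q (r *\<^sub>R h) (r * t)"
proof (cases r "0::real" rule: linorder_cases)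
  case less
  then show ?thesis
    using cut_minus[OF cut_scaleR_pos[OF assms, of "- r"]] by simp
next
  case equal
  then show ?thesis
    using cut_of_real[of 0] by simp
next
  case greater
  then show ?thesis
    using cut_scaleR_pos[OF assms] by simp
qed

text \<open>
  The value is multiplicative, but only this inequality is needed. It follows from
  \<open>(h - (t - e)) (t + e - h) = e\<^sup>2 - (h - t)\<^sup>2\<close>, a product of members of \<open>Q\<close>.
\<close>

lemma cut_square_le:
  assumes h: "cut Q h t" and hh: "cut Q (h * h) u"
  shows "u \<le> t\<^sup>2"
proof (rule ccontr)
  assume "\<not> u \<le> t\<^sup>2"
  define e where "e = sqrt (u - t\<^sup>2) / 2"
  have e: "e > 0" "e\<^sup>2 < u - t\<^sup>2"
    using \<open>\<not> u \<le> t\<^sup>2\<close> by (simp_all add: e_def power_divide)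
  \<comment> \<open>\<open>2th + e\<^sup>2 - t\<^sup>2\<close> is an upper bound of \<open>h\<^sup>2\<close> in the order, with value
    \<open>t\<^sup>2 + e\<^sup>2 < u\<close>.\<close>
  have "cut Q ((2 * t) *\<^sub>R h + of_real (e\<^sup>2 - t\<^sup>2)) (2 * t * t + (e\<^sup>2 - t\<^sup>2))"
    by (intro cut_add cut_scaleR cut_of_real h)
  moreover have "((2 * t) *\<^sub>R h + of_real (e\<^sup>2 - t\<^sup>2)) - h * h \<in> Q"
  proof -
    have "((2 * t) *\<^sub>R h + of_real (e\<^sup>2 - t\<^sup>2)) - h * h
        = (h - of_real (t - e)) * (of_real (t + e) - h)"
      by (simp add: scaleR_conv_of_real algebra_simps power2_eq_square)
    then show ?thesis
      using preordering_mult[OF cutD[OF h e(1)]] by simp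
  qed
  ultimately have "u \<le> 2 * t * t + (e\<^sup>2 - t\<^sup>2)"
    using hh cut_le by blast
  with e show False
    by (simp add: power2_eq_square)
qed

lemma cut_exists:
  assumes total: "\<And>h. adj h = h \<Longrightarrow> h \<in> Q \<or> - h \<in> Q" and h: "adj h = h"
  shows "\<exists>t. cut Q h t"
proof
  define L where "L = {r. h - of_real r \<in> Q}"
  have "h - of_real (- norm h) \<in> Q"
    using norm_plus_mem_pos_cone[OF h order_refl]
    by (intro pos_cone_subset_preordering) (simp add: add.commute)
  then have "- norm h \<in> L"
    unfolding L_def by (rule CollectI)
  then have ne: "L \<noteq> {}" by blast
  have bdd: "bdd_above L"
  proof (rule bdd_aboveI)
    fix r assume "r \<in> L"
    then have "(h - of_real r) + (of_real (norm h) - h) \<in> Q"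
      unfolding L_def using norm_minus_mem_pos_cone[OF h order_refl]
      by (intro preordering_add) (simp_all add: pos_cone_subset_preordering)
    also have "(h - of_real r) + (of_real (norm h) - h) = of_real (norm h - r)"
      by simp
    finally show "r \<le> norm h"
      unfolding of_real_mem_preordering_iff by simp
  qed
  show "cut Q h (Sup L)"
  proof (rule cutI)
    fix e :: real
    assume "e > 0"
    then obtain r where "r \<in> L" "Sup L - e < r"
      using less_cSup_iff[OF ne bdd, of "Sup L - e"] by auto
    then have "(h - of_real r) + of_real (r - (Sup L - e)) \<in> Q"
      by (intro preordering_add iffD2[OF of_real_mem_preordering_iff]) (simp_all add: L_def)
    then show "h - of_real (Sup L - e) \<in> Q"
      by (simp add: algebra_simps)
    have "Sup L + e \<notin> L"
      using cSup_upper[OF _ bdd, of "Sup L + e"] \<open>e > 0\<close> by auto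
    then show "of_real (Sup L + e) - h \<in> Q"
      using total[of "h - of_real (Sup L + e)"] h by (auto simp: L_def adj_diff adj_add)
  qed
qed

end

section \<open>States\<close>

text \<open>
  The preordering generated by \<open>f\<^sup>*f - (norm f)\<^sup>2\<close> is proper, for otherwise \<open>(norm f)\<^sup>2 - f\<^sup>*f\<close>
  would be bounded below by a positive number and \<open>norm (f\<^sup>*f)\<close> would be less than
  \<open>(norm f)\<^sup>2\<close>. The cuts in a maximal preordering above it define a state \<open>s\<close> with
  \<open>s (f\<^sup>*f) \<ge> (norm f)\<^sup>2\<close>, and \<open>cut_square_le\<close> passes from \<open>f\<^sup>*f\<close> to \<open>f\<close>.
\<close>

lemma norm_attaining_state_exists:
  fixes f :: "'a::{unital_cstar_algebra, comm_ring_1}"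
  obtains s where "is_state s" "norm f \<le> cmod (s f)"
proof -
  define g where "g = adj f * f - of_real ((norm f)\<^sup>2)"
  have "adj g = g"
    by (simp add: g_def adj_diff adj_mult adj_adj adj_power)
  have "a + g * b \<noteq> - 1" if ab: "a \<in> pos_cone" "b \<in> pos_cone" for a b
  proof
    assume eq: "a + g * b = - 1"
    \<comment> \<open>\<open>\<beta> \<ge> b\<close> gives \<open>- \<beta>g \<ge> - gb = 1 + a \<ge> 1\<close>.\<close>
    define \<beta> where "\<beta> = norm b + 1"
    have "\<beta> > 0" by (simp add: \<beta>_def add_nonneg_pos)
    have "of_real \<beta> - b \<in> pos_cone"
      by (rule norm_minus_mem_pos_cone) (simp_all add: \<beta>_def pos_cone_adj ab)
    moreover have "- g \<in> pos_cone"
      unfolding g_def minus_diff_eq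
      by (rule norm_minus_mem_pos_cone) (simp_all add: adj_mult adj_adj cstar_identity)
    ultimately have "(- g) * (of_real \<beta> - b) + a \<in> pos_cone"
      by (intro pos_cone_add pos_cone_mult ab)
    also have "(- g) * (of_real \<beta> - b) + a = \<beta> *\<^sub>R (- g) - 1"
      using eq by (simp add: scaleR_conv_of_real algebra_simps)
    finally have "(1 / \<beta>) *\<^sub>R (\<beta> *\<^sub>R (- g) - 1) \<in> pos_cone"
      using \<open>\<beta> > 0\<close> by (intro pos_cone_scaleR) simp_all
    also have "(1 / \<beta>) *\<^sub>R (\<beta> *\<^sub>R (- g) - 1) = - g - of_real (1 / \<beta>)"
      using \<open>\<beta> > 0\<close> by (simp add: scaleR_diff_right of_real_def)
    finally have "of_real ((norm f)\<^sup>2 - 1 / \<beta>) - adj f * f \<in> pos_cone"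
      by (simp add: g_def algebra_simps)
    moreover have "adj f * f \<in> pos_cone"
      unfolding pos_cone_def by blast
    ultimately have "norm (adj f * f) \<le> (norm f)\<^sup>2 - 1 / \<beta>"
      by (rule norm_le_of_diff_mem_pos_cone[rotated])
    then show False
      using \<open>\<beta> > 0\<close> by (simp add: cstar_identity)
  qed
  then obtain Q where "proper_preordering Q" "g \<in> Q"
    using preordering_adjoin[OF proper_preordering_pos_cone \<open>adj g = g\<close>] by metis
  then obtain M where M: "proper_preordering M" "g \<in> M"
    and max: "\<And>R. proper_preordering R \<Longrightarrow> M \<subseteq> R \<Longrightarrow> R = M"
    by (meson maximal_preordering_exists subsetD)
  have "\<exists>t. cut M h t" if "adj h = h" for h
    using cut_exists[OF M(1) maximal_preordering_total[OF M(1) max] that] by blast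
  then obtain \<phi> where \<phi>: "\<And>h. adj h = h \<Longrightarrow> cut M h (\<phi> h)"
    by metis
  have \<phi>_eq: "\<phi> h = t" if "cut M h t" "adj h = h" for h t
    using cut_unique[OF M(1)] \<phi> that by blast
  have \<phi>_add: "\<phi> (h + k) = \<phi> h + \<phi> k" if "adj h = h" "adj k = k" for h k
    using that by (intro \<phi>_eq cut_add[OF M(1)] \<phi>) (simp_all add: adj_add)
  have \<phi>_scaleR: "\<phi> (r *\<^sub>R h) = r * \<phi> h" if "adj h = h" for r h
    using that by (intro \<phi>_eq cut_scaleR[OF M(1)] \<phi>) simp_all
  have \<phi>_of_real: "\<phi> (of_real r) = r" for r
    by (intro \<phi>_eq cut_of_real[OF M(1)]) simp
  have \<phi>_nonneg: "\<phi> h \<ge> 0" if "h \<in> M" for h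
    using cut_le[OF M(1) cut_of_real[OF M(1), of 0] \<phi>[of h]] that preordering_adj[OF M(1)] by simp
  define s where "s = (\<lambda>x. Complex (\<phi> (re_part x)) (\<phi> (im_part x)))"
  have s_selfadjoint: "s h = of_real (\<phi> h)" if "adj h = h" for h
    using that \<phi>_of_real[of 0] by (simp add: s_def re_im_part_selfadjoint complex_eq_iff)
  have "s (x + y) = s x + s y" for x y
    by (simp add: s_def re_part_add im_part_add \<phi>_add complex_eq_iff)
  moreover have "s (z *\<^sub>C x) = z * s x" for z x
  proof -
    have "\<phi> (r *\<^sub>R h + q *\<^sub>R k) = r * \<phi> h + q * \<phi> k" if "adj h = h" "adj k = k" for r q h k
      using that by (simp add: \<phi>_add \<phi>_scaleR)
    from this[of _ _ _ "- q" for q] this show ?thesis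
      by (simp add: s_def re_im_part_scaleC complex_eq_iff)
  qed
  moreover have "vector_space ((*) :: complex \<Rightarrow> complex \<Rightarrow> complex)"
    by unfold_locales (simp_all add: algebra_simps)
  ultimately have "Vector_Spaces.linear scaleC (*) s"
    by (simp add: Vector_Spaces.linear_iff vector_space_scaleC)
  moreover have "s ` pos_cone \<subseteq> \<real>\<^sub>\<ge>\<^sub>0"
    using \<phi>_nonneg pos_cone_subset_preordering[OF M(1)] by (auto simp: s_selfadjoint pos_cone_adj)
  moreover have "s 1 = 1"
    using \<phi>_of_real[of 1] by (simp add: s_selfadjoint)
  ultimately have "is_state s"
    by (simp add: is_state_def)
  moreover have "norm f \<le> cmod (s f)"
  proof -
    define x y where "x = re_part f" and "y = im_part f"
    have xy: "adj x = x" "adj y = y"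
      by (simp_all add: x_def y_def)
    have sq: "\<phi> (h * h) \<le> (\<phi> h)\<^sup>2" if "adj h = h" for h
      using that by (intro cut_square_le[OF M(1) \<phi> \<phi>]) (simp_all add: adj_mult)
    have "adj f * f = g + of_real ((norm f)\<^sup>2)"
      by (simp add: g_def)
    then have "\<phi> (adj f * f) = \<phi> g + (norm f)\<^sup>2"
      by (simp only: \<phi>_add \<phi>_of_real \<open>adj g = g\<close> adj_of_real)
    then have "(norm f)\<^sup>2 \<le> \<phi> (adj f * f)"
      using \<phi>_nonneg[OF M(2)] by simp
    also have "\<dots> = \<phi> (x * x) + \<phi> (y * y)"
      unfolding adj_mult_self x_def y_def by (rule \<phi>_add) (simp_all add: adj_mult)
    also have "\<dots> \<le> (\<phi> x)\<^sup>2 + (\<phi> y)\<^sup>2"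
      by (intro add_mono sq xy)
    also have "\<dots> = (cmod (s f))\<^sup>2"
      by (simp add: s_def x_def y_def cmod_power2)
    finally show ?thesis
      by (rule power2_le_imp_le) simp
  qed
  ultimately show thesis ..
qed

lemma cmod_state_le_order_norm:
  fixes p :: "'i \<Rightarrow> 'a::{unital_cstar_algebra, comm_ring_1}"
  assumes s: "is_state s" and p: "\<And>i. i \<in> I \<Longrightarrow> p i \<in> pos_cone"
  shows "cmod (s (\<Sum>i\<in>I. l i *\<^sub>C p i)) \<le> order_norm (\<Sum>i\<in>I. cmod (l i) *\<^sub>R p i)"
proof -
  define v where "v = (\<Sum>i\<in>I. cmod (l i) *\<^sub>R p i)"
  have s_add: "s (x + y) = s x + s y" and s_scaleC: "s (z *\<^sub>C x) = z * s x" for x y z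
    using s by (simp_all add: is_state_def Vector_Spaces.linear_iff)
  have s_scaleR: "s (r *\<^sub>R x) = of_real r * s x" for r x
    by (simp add: scaleR_scaleC s_scaleC)
  have s_sum: "s (sum g I) = (\<Sum>i\<in>I. s (g i))" for g :: "'i \<Rightarrow> 'a"
    using s_scaleR[of 0]
    by (induction I rule: infinite_finite_induct) (simp_all add: s_add)
  have s_pos: "Re (s a) \<ge> 0" "s a = of_real (Re (s a))" if "a \<in> pos_cone" for a
    using s that by (auto simp: is_state_def image_subset_iff nonneg_Reals_def)
  have "cmod (s (\<Sum>i\<in>I. l i *\<^sub>C p i)) \<le> (\<Sum>i\<in>I. cmod (l i) * Re (s (p i)))"
    unfolding s_sum s_scaleC
  proof (rule sum_norm_le)
    fix i assume "i \<in> I"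
    then have "cmod (s (p i)) = Re (s (p i))"
      using s_pos[OF p] by (metis abs_of_nonneg norm_of_real)
    then show "cmod (l i * s (p i)) \<le> cmod (l i) * Re (s (p i))"
      by (simp add: norm_mult)
  qed
  also have "\<dots> = Re (s v)"
    by (simp add: v_def s_sum s_scaleR)
  also have "\<dots> \<le> order_norm v"
    unfolding order_norm_def
  proof (rule cInf_greatest[OF order_norm_set_nonempty])
    show "adj v = v"
      unfolding v_def by (intro pos_cone_adj pos_cone_sum pos_cone_scaleR p) simp_all
    fix r assume "r \<in> {r. r *\<^sub>R 1 + v \<in> pos_cone \<and> r *\<^sub>R 1 - v \<in> pos_cone}"
    then have "Re (s (r *\<^sub>R 1 - v)) \<ge> 0"
      using s_pos(1) by blast
    moreover have "s (r *\<^sub>R 1 - v) = of_real r - s v"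
      using s_add[of "r *\<^sub>R 1" "(-1) *\<^sub>R v"] s_scaleR[of "-1" v] s_scaleR[of r 1] s
      by (simp add: is_state_def)
    ultimately show "Re (s v) \<le> r"
      by simp
  qed
  finally show ?thesis
    by (simp only: v_def)
qed

theorem proposition5p11:
  fixes f :: "'a::{unital_cstar_algebra, comm_ring_1}"
  shows "min_norm f = dec_norm f"
proof (rule antisym)
  define D where "D = {order_norm (\<Sum>i=1..n. cmod (l i) *\<^sub>R p i) | (n::nat) l p.
     f = (\<Sum>i=1..n. l i *\<^sub>C p i) \<and> (\<forall>i\<in>{1..n}. p i \<in> pos_cone)}"
  have dec_norm_eq: "dec_norm f = Inf D"
    by (simp only: dec_norm_def D_def)
  have D_approx: "\<exists>d\<in>D. d \<le> c" if less: "norm f < c" for c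
  proof -
    obtain n :: nat and l p where nlp: "f = (\<Sum>i=1..n. l i *\<^sub>C p i)"
      "\<And>i. i \<in> {1..n} \<Longrightarrow> p i \<in> pos_cone" "order_norm (\<Sum>i=1..n. cmod (l i) *\<^sub>R p i) \<le> c"
      using near_optimal_decomposition[OF less] by blast
    then have "order_norm (\<Sum>i=1..n. cmod (l i) *\<^sub>R p i) \<in> D"
      unfolding D_def by blast
    with nlp(3) show ?thesis by blast
  qed
  then have "D \<noteq> {}"
    using less_add_one[of "norm f"] by blast
  have D_lower: "cmod (s f) \<le> d" if s: "is_state s" and d: "d \<in> D" for s d
  proof -
    obtain n :: nat and l p where nlp: "d = order_norm (\<Sum>i=1..n. cmod (l i) *\<^sub>R p i)"
      "f = (\<Sum>i=1..n. l i *\<^sub>C p i)" "\<forall>i\<in>{1..n}. p i \<in> pos_cone"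
      using d unfolding D_def by blast
    show ?thesis
      unfolding nlp(1,2) using nlp(3) by (intro cmod_state_le_order_norm[OF s]) blast
  qed
  have state_le: "cmod (s f) \<le> dec_norm f" if "is_state s" for s
    unfolding dec_norm_eq using that D_lower by (intro cInf_greatest[OF \<open>D \<noteq> {}\<close>])
  obtain s where s: "is_state s" "norm f \<le> cmod (s f)"
    by (rule norm_attaining_state_exists)
  show "min_norm f \<le> dec_norm f"
    unfolding min_norm_def using s(1) state_le by (intro cSup_least) auto
  have "bdd_below D"
    using D_lower[OF s(1)] by (rule bdd_belowI)
  have "dec_norm f \<le> norm f"
  proof (rule dense_ge)
    fix c assume "norm f < c"
    then show "dec_norm f \<le> c"
      using D_approx cInf_lower2[OF _ _ \<open>bdd_below D\<close>] unfolding dec_norm_eq by blast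
  qed
  also note s(2)
  also have "cmod (s f) \<le> min_norm f"
    unfolding min_norm_def using s(1) state_le
    by (intro cSup_upper bdd_aboveI[where M = "dec_norm f"]) auto
  finally show "dec_norm f \<le> min_norm f" .
qed

end
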